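(* Assume that the entire function $G\in\Gamma(N,\mathcal{O}_N)$ is a trace form. Then $G$ satisfies the system $$(\partial_p\partial_q-\partial_{p+1}\partial_{q-1})[G]=0\quad\text{for all }p,q\text{ with }p,q,p+1,q-1\in[1,k],$$ $$(\mathcal{T}^m+\partial_m)[G]=0\quad\text{for all }m\in[2,k].$$ Moreover, for any $h\in[1,k]$ there exists a trace function $F_h$ such that $G=\partial_h F_h$.
   Context: Let $k$ be a positive integer and $N=\mathbb{C}^k$ with coordinates $\sigma=(\sigma_1,\dots,\sigma_k)$; write $\partial_h=\frac{\partial}{\partial\sigma_h}$, and let $[a,b]$ denote the set of integers from $a$ to $b$. For $\sigma\in N$ put $P_\sigma(z)=z^k+\sum_{h=1}^k(-1)^h\sigma_hz^{k-h}$, with roots $x_1,\dots,x_k$ counted with multiplicity, and let $\Delta(\sigma)$ be its discriminant. For $m\in[2,k]$ put $$\mathcal{T}^m=\partial_1\partial_{m-1}+\Big(\sum_{h=1}^k\sigma_h\partial_h\Big)\partial_m+\partial_m.$$ An entire function $F$ on $N$ is a trace function if there is an entire function $f:\mathbb{C}\to\mathbb{C}$ with $F(\sigma)=\sum_{j=1}^kf(x_j)$ for all $\sigma\in N$. An entire function $G$ on $N$ is a trace form if there is an entire function $g:\mathbb{C}\to\mathbb{C}$ with $G(\sigma)=\sum_{j=1}^k\frac{g(x_j)}{P'_\sigma(x_j)}$ for all $\sigma$ with $\Delta(\sigma)\ne0$ (the right-hand side extends holomorphically to $N$). *)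

theory Defs
  imports "HOL-Complex_Analysis.Complex_Analysis" "Subresultants.Resultant_Prelim"
begin

no_notation vec_index (infixl "$" 100)

text \<open>
  The space \<open>N = \<complex>\<^sup>k\<close> is rendered as \<^typ>\<open>complex ^ 'n\<close> together with a labelling
  \<open>\<iota> :: nat \<Rightarrow> 'n\<close> of the coordinates that is a bijection from \<open>{1..k}\<close> onto the index type
  (the type has no intrinsic numbering of its coordinates). The coordinate \<open>\<sigma>\<^sub>h\<close> is \<open>\<sigma> $ \<iota> h\<close>.
\<close>

text \<open>Holomorphy on \<open>\<complex>\<^sup>k\<close>: the real Frechet derivative exists everywhere and is complex linear
  (additivity is already part of \<^const>\<open>has_derivative\<close>).\<close>

definition entire :: "(complex ^ 'n::finite \<Rightarrow> complex) \<Rightarrow> bool" where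
  "entire F \<longleftrightarrow>
     (\<forall>\<sigma>. \<exists>D. (F has_derivative D) (at \<sigma>) \<and> (\<forall>c v. D (c *s v) = c * D v))"

definition pdiff ::
    "(nat \<Rightarrow> 'n::finite) \<Rightarrow> nat \<Rightarrow> (complex ^ 'n \<Rightarrow> complex) \<Rightarrow> complex ^ 'n \<Rightarrow> complex" where
  "pdiff \<iota> h F \<sigma> = deriv (\<lambda>t. F (\<sigma> + t *s axis (\<iota> h) 1)) 0"

definition sigma_poly :: "nat \<Rightarrow> (nat \<Rightarrow> 'n::finite) \<Rightarrow> complex ^ 'n \<Rightarrow> complex poly" where
  "sigma_poly k \<iota> \<sigma> = monom 1 k + (\<Sum>h = 1..k. monom ((-1) ^ h * \<sigma> $ \<iota> h) (k - h))"

definition discriminant :: "'a::field poly \<Rightarrow> 'a" where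
  "discriminant p =
     (-1) ^ (degree p * (degree p - 1) div 2) * resultant p (pderiv p) / lead_coeff p"

definition T_op ::
    "nat \<Rightarrow> (nat \<Rightarrow> 'n::finite) \<Rightarrow> nat \<Rightarrow> (complex ^ 'n \<Rightarrow> complex) \<Rightarrow> complex ^ 'n \<Rightarrow> complex" where
  "T_op k \<iota> m F \<sigma> =
     pdiff \<iota> 1 (pdiff \<iota> (m - 1) F) \<sigma>
     + (\<Sum>h = 1..k. \<sigma> $ \<iota> h * pdiff \<iota> h (pdiff \<iota> m F) \<sigma>)
     + pdiff \<iota> m F \<sigma>"

text \<open>Below, \<^const>\<open>proots\<close> is the multiset of roots, so the sums respect multiplicities.\<close>

definition trace_function ::
    "nat \<Rightarrow> (nat \<Rightarrow> 'n::finite) \<Rightarrow> (complex ^ 'n \<Rightarrow> complex) \<Rightarrow> bool" where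
  "trace_function k \<iota> F \<longleftrightarrow>
     entire F \<and>
     (\<exists>f. f holomorphic_on UNIV \<and> (\<forall>\<sigma>. F \<sigma> = (\<Sum>x\<in>#proots (sigma_poly k \<iota> \<sigma>). f x)))"

definition trace_form ::
    "nat \<Rightarrow> (nat \<Rightarrow> 'n::finite) \<Rightarrow> (complex ^ 'n \<Rightarrow> complex) \<Rightarrow> bool" where
  "trace_form k \<iota> G \<longleftrightarrow>
     entire G \<and>
     (\<exists>g. g holomorphic_on UNIV \<and>
        (\<forall>\<sigma>. discriminant (sigma_poly k \<iota> \<sigma>) \<noteq> 0 \<longrightarrow>
           G \<sigma> = (\<Sum>x\<in>#proots (sigma_poly k \<iota> \<sigma>).
                    g x / poly (pderiv (sigma_poly k \<iota> \<sigma>)) x)))"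

end

theory Submission
  imports
    Defs
    "HOL-Computational_Algebra.Field_as_Ring"
    "HOL-Computational_Algebra.Fundamental_Theorem_Algebra"
    "Subresultants.Subresultant_Gcd"
begin

no_notation vec_index (infixl "$" 100)
no_notation fps_nth (infixl "$" 75)

text \<open>
  Everything follows from an integral representation. By the residue theorem, a trace form with
  density \<open>g\<close> equals \<open>G \<sigma> = (1 / 2\<pi>\<i>) \<integral> g(z) / P\<^sub>\<sigma>(z) dz\<close> over any circle enclosing the roots of
  \<open>P\<^sub>\<sigma>\<close>, first where \<open>P\<^sub>\<sigma>\<close> has simple roots and then, by continuity, everywhere
  (\<open>trace_form_eq_J\<close>). One circle serves all \<open>\<sigma>\<close> in a given ball, so that one may differentiate under
  the integral sign. Since \<open>P\<^sub>\<sigma>\<close> is affine in \<open>\<sigma>\<close> with \<open>\<partial>\<^sub>h P\<^sub>\<sigma>(z) = (-1)^h z^(k-h)\<close>, this gives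
  \<open>\<partial>\<^sub>p \<partial>\<^sub>q G = (1 / 2\<pi>\<i>) \<integral> 2 (-1)^(p+q) z^(2k-p-q) g / P\<^sub>\<sigma>\<^sup>3\<close> (\<open>J_second_derivative\<close>). The right-hand
  side depends on \<open>p + q\<close> only, which is the first system. For the second one, summing
  \<open>\<sigma>\<^sub>h \<partial>\<^sub>h \<partial>\<^sub>m G\<close> produces the factor \<open>P\<^sub>\<sigma>(z) - z^k\<close>, the term \<open>\<partial>\<^sub>1 \<partial>\<^sub>m\<^sub>-\<^sub>1 G\<close> produces \<open>z^k\<close>, and
  \<open>2 \<partial>\<^sub>m G\<close> cancels the sum \<open>P\<^sub>\<sigma>(z)\<close> of the two (\<open>J_T_op\<close>).

  A trace function is likewise \<open>F \<sigma> = (1 / 2\<pi>\<i>) \<integral> f P\<^sub>\<sigma>' / P\<^sub>\<sigma>\<close>. Differentiating and integrating by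
  parts yields \<open>\<partial>\<^sub>h F = - (-1)^h (1 / 2\<pi>\<i>) \<integral> f' z^(k-h) / P\<^sub>\<sigma>\<close> (\<open>has_complex_derivative_trace\<close>). Hence
  \<open>\<partial>\<^sub>h F = G\<close> asks for \<open>- (-1)^h z^(k-h) f' = g\<close>, which can be solved after removing from \<open>g\<close> its
  Taylor polynomial of degree below \<open>k - h\<close>. The removed part is harmless: \<open>\<integral> q / P\<^sub>\<sigma> = 0\<close> for every
  polynomial \<open>q\<close> of degree at most \<open>k - 2\<close>, as one sees by letting the radius tend to infinity
  (\<open>circle_integral_poly_fraction_0\<close>).
\<close>

section \<open>Complex derivatives on \<open>\<complex>\<^sup>k\<close>\<close>

text \<open>
  The complex Frechet derivative. Keeping the linear map explicit lets all partial derivatives be read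
  off at once, by evaluation at the coordinate vectors.
\<close>

definition has_complex_derivative ::
    "(complex ^ 'n::finite \<Rightarrow> complex) \<Rightarrow> (complex ^ 'n \<Rightarrow> complex) \<Rightarrow> complex ^ 'n \<Rightarrow> bool" where
  "has_complex_derivative F D \<sigma> \<longleftrightarrow>
     (F has_derivative D) (at \<sigma>) \<and> (\<forall>c v. D (c *s v) = c * D v)"

lemma entire_iff: "entire F \<longleftrightarrow> (\<forall>\<sigma>. \<exists>D. has_complex_derivative F D \<sigma>)"
  by (simp add: entire_def has_complex_derivative_def)

lemma has_complex_derivative_transform:
  assumes "has_complex_derivative F D \<sigma>" "open U" "\<sigma> \<in> U" "\<And>\<tau>. \<tau> \<in> U \<Longrightarrow> F \<tau> = H \<tau>"
  shows "has_complex_derivative H D \<sigma>"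
  using assms unfolding has_complex_derivative_def
  by (blast intro: has_derivative_transform_within_open)

lemma pdiff_eq_derivative_axis:
  assumes "has_complex_derivative F D \<sigma>"
  shows "pdiff \<iota> h F \<sigma> = D (axis (\<iota> h) 1)"
proof -
  let ?e = "axis (\<iota> h) 1 :: complex ^ 'a"
  have lin: "D (c *s v) = c * D v" for c v
    using assms by (simp add: has_complex_derivative_def)
  have "bounded_linear (\<lambda>t::complex. t *s ?e)"
    by (rule linear_conv_bounded_linear[THEN iffD1], rule linearI)
       (simp_all add: Finite_Cartesian_Product.vec_eq_iff distrib_right)
  then have "((\<lambda>t. \<sigma> + t *s ?e) has_derivative (\<lambda>t. 0 + t *s ?e)) (at 0)"
    by (intro has_derivative_add has_derivative_const bounded_linear_imp_has_derivative)
  then have "((\<lambda>t. \<sigma> + t *s ?e) has_derivative (\<lambda>t. t *s ?e)) (at 0)"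
    by simp
  moreover have "(F has_derivative D) (at (\<sigma> + 0 *s ?e))"
    using assms by (simp add: has_complex_derivative_def)
  ultimately have "((\<lambda>t. F (\<sigma> + t *s ?e)) has_derivative (\<lambda>t. D (t *s ?e))) (at 0)"
    by (rule has_derivative_compose)
  moreover have "(\<lambda>t. D (t *s ?e)) = (*) (D ?e)"
    by (simp add: lin fun_eq_iff)
  ultimately have "((\<lambda>t. F (\<sigma> + t *s ?e)) has_field_derivative D ?e) (at 0)"
    by (simp add: has_field_derivative_def)
  then show ?thesis
    unfolding pdiff_def by (rule DERIV_imp_deriv)
qed

text \<open>
  Second order partial derivatives need this locality: the integral representation of a function holds
  on a ball only, since the circle of integration depends on the ball.
\<close>

lemma pdiff_cong:
  assumes "open U" "\<sigma> \<in> U" "\<And>\<tau>. \<tau> \<in> U \<Longrightarrow> F \<tau> = H \<tau>"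
  shows "pdiff \<iota> h F \<sigma> = pdiff \<iota> h H \<sigma>"
  unfolding pdiff_def
proof (rule deriv_cong_ev)
  let ?\<gamma> = "\<lambda>t. \<sigma> + t *s axis (\<iota> h) 1"
  have "continuous_on UNIV ?\<gamma>"
    unfolding vector_scalar_mult_def by (intro continuous_intros)
  then have "open (?\<gamma> -` U)"
    using assms(1) by (intro open_vimage)
  then have "\<forall>\<^sub>F t in nhds 0. t \<in> ?\<gamma> -` U"
    using assms(2) by (intro eventually_nhds_in_open) auto
  then show "\<forall>\<^sub>F t in nhds 0. F (?\<gamma> t) = H (?\<gamma> t)"
    by eventually_elim (use assms(3) in auto)
qed simp

lemma has_complex_derivative_compose:
  assumes "has_complex_derivative F D \<sigma>" "(f has_field_derivative d) (at (F \<sigma>))"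
  shows "has_complex_derivative (\<lambda>\<sigma>. f (F \<sigma>)) (\<lambda>v. d * D v) \<sigma>"
  using assms has_derivative_compose[of F D \<sigma> UNIV f "(*) d"]
  by (simp add: has_complex_derivative_def has_field_derivative_def)

lemma has_complex_derivative_mult:
  assumes "has_complex_derivative F D \<sigma>" "has_complex_derivative H E \<sigma>"
  shows "has_complex_derivative (\<lambda>\<sigma>. F \<sigma> * H \<sigma>) (\<lambda>v. F \<sigma> * E v + D v * H \<sigma>) \<sigma>"
  using assms by (auto simp: has_complex_derivative_def algebra_simps intro!: derivative_eq_intros)

lemma has_field_derivative_const_over_power:
  fixes w :: complex
  assumes "w \<noteq> 0"
  shows "((\<lambda>w. c / w ^ n) has_field_derivative - of_nat n * c / w ^ Suc n) (at w)"
proof (cases n)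
  case (Suc m)
  have "((\<lambda>w. c / w ^ n) has_field_derivative (0 * w ^ n - c * (of_nat n * w ^ (n - Suc 0))) / (w ^ n * w ^ n)) (at w)"
    using assms by (auto intro!: derivative_eq_intros)
  also have "(0 * w ^ n - c * (of_nat n * w ^ (n - Suc 0))) / (w ^ n * w ^ n) = - of_nat n * c / w ^ Suc n"
    using assms by (simp add: Suc divide_simps) (simp add: algebra_simps)
  finally show ?thesis .
qed simp

text \<open>
  The quotient rule for \<open>f l / p\<close>, with the term containing \<open>f'\<close> set apart for integration by parts.
\<close>

lemma quotient_rule_split:
  fixes p :: complex
  assumes "p \<noteq> 0"
  shows "((f' * l + l' * f) * p - f * l * p') / (p * p) =
         (f * p' * (- l / p ^ 2) + f * l' / p) - (- f' * l / p ^ 1)"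
  using assms by (simp add: field_simps power2_eq_square)

section \<open>Circle integrals depending on a parameter\<close>

text \<open>
  Pulling the integral back to the parameter interval of the circle turns this into the Leibniz rule
  for an integral over a compact interval. That rule wants the derivative to be continuous as a map
  into the bounded linear operators, which in finite dimensions is continuity at each basis vector.
\<close>

lemma has_derivative_circle_integral:
  fixes \<Phi> :: "'a::euclidean_space \<Rightarrow> complex \<Rightarrow> complex"
  assumes U: "convex U" "open U" "s \<in> U"
    and der: "\<And>s z. s \<in> U \<Longrightarrow> z \<in> sphere 0 \<bar>R\<bar> \<Longrightarrow> ((\<lambda>s. \<Phi> s z) has_derivative D s z) (at s)"
    and contD: "\<And>v. continuous_on (U \<times> sphere 0 \<bar>R\<bar>) (\<lambda>(s, z). D s z v)"
    and cont\<Phi>: "\<And>s. s \<in> U \<Longrightarrow> continuous_on (sphere 0 \<bar>R\<bar>) (\<Phi> s)"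
  shows "((\<lambda>s. contour_integral (circlepath 0 R) (\<Phi> s)) has_derivative
          (\<lambda>v. contour_integral (circlepath 0 R) (\<lambda>z. D s z v))) (at s)"
proof -
  define \<gamma> where "\<gamma> = circlepath 0 R"
  define \<gamma>' where "\<gamma>' = (\<lambda>t. 2 * pi * \<i> * R * exp (2 * of_real pi * \<i> * of_real t))"
  define fx where "fx = (\<lambda>s t. Blinfun (\<lambda>v. D s (\<gamma> t) v * \<gamma>' t))"
  have \<gamma>: "\<gamma> t \<in> sphere 0 \<bar>R\<bar>" if "t \<in> cbox 0 1" for t
    using that path_image_circlepath[of 0 R] unfolding path_image_def \<gamma>_def by force
  have cont\<gamma>: "continuous_on (cbox 0 1) \<gamma>"
    using valid_path_imp_path[of "circlepath 0 R"] by (simp add: path_def \<gamma>_def)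
  have cont\<gamma>': "continuous_on A \<gamma>'" for A
    unfolding \<gamma>'_def by (intro continuous_intros)
  have int: "contour_integral \<gamma> F = integral (cbox 0 1) (\<lambda>t. F (\<gamma> t) * \<gamma>' t)" for F
    unfolding contour_integral_integral \<gamma>_def \<gamma>'_def
    by (simp add: vector_derivative_circlepath mult.assoc)
  have fx: "blinfun_apply (fx s t) = (\<lambda>v. D s (\<gamma> t) v * \<gamma>' t)" if "s \<in> U" "t \<in> cbox 0 1" for s t
    unfolding fx_def using has_derivative_bounded_linear[OF der[OF that(1) \<gamma>[OF that(2)]]]
    by (intro bounded_linear_Blinfun_apply bounded_linear_mult_const)
  have contfx: "continuous_on (U \<times> cbox 0 1) (\<lambda>(s, t). fx s t)"
  proof (rule continuous_on_blinfun_componentwise)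
    fix i :: 'a assume "i \<in> Basis"
    have "continuous_on (U \<times> cbox 0 1) ((\<lambda>(s, z). D s z i) \<circ> (\<lambda>(s, t). (s, \<gamma> t)))"
    proof (rule continuous_on_compose)
      show "continuous_on (U \<times> cbox 0 1) (\<lambda>(s, t). (s, \<gamma> t))"
        unfolding case_prod_beta
        by (intro continuous_intros continuous_on_compose2[OF cont\<gamma>]) auto
      show "continuous_on ((\<lambda>(s, t). (s, \<gamma> t)) ` (U \<times> cbox 0 1)) (\<lambda>(s, z). D s z i)"
        by (rule continuous_on_subset[OF contD]) (use \<gamma> in auto)
    qed
    moreover have "continuous_on (U \<times> cbox 0 1) (\<lambda>x. \<gamma>' (snd x))"
      by (intro continuous_on_compose2[OF cont\<gamma>'[of UNIV]] continuous_intros) auto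
    ultimately have "continuous_on (U \<times> cbox 0 1) (\<lambda>x. D (fst x) (\<gamma> (snd x)) i * \<gamma>' (snd x))"
      by (intro continuous_on_mult) (auto simp: o_def case_prod_beta)
    then show "continuous_on (U \<times> cbox 0 1) (\<lambda>x. blinfun_apply (case x of (s, t) \<Rightarrow> fx s t) i)"
      by (rule continuous_on_eq) (auto simp: fx)
  qed
  have "((\<lambda>s. integral (cbox 0 1) (\<lambda>t. \<Phi> s (\<gamma> t) * \<gamma>' t)) has_derivative
          blinfun_apply (integral (cbox 0 1) (fx s))) (at s within U)"
  proof (rule leibniz_rule[OF _ _ contfx U(3,1)])
    show "((\<lambda>s. \<Phi> s (\<gamma> t) * \<gamma>' t) has_derivative blinfun_apply (fx s t)) (at s within U)"
      if "s \<in> U" "t \<in> cbox 0 1" for s t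
      unfolding fx[OF that]
      by (intro has_derivative_mult_left has_derivative_at_withinI[OF der[OF that(1) \<gamma>[OF that(2)]]])
    show "(\<lambda>t. \<Phi> s (\<gamma> t) * \<gamma>' t) integrable_on cbox 0 1" if "s \<in> U" for s
      by (intro integrable_continuous continuous_intros cont\<gamma>' continuous_on_compose2[OF cont\<Phi>[OF that] cont\<gamma>])
         (use \<gamma> in auto)
  qed
  moreover have "blinfun_apply (integral (cbox 0 1) (fx s)) v = contour_integral \<gamma> (\<lambda>z. D s z v)" for v
  proof -
    have "continuous_on (cbox 0 1) (fx s)"
    proof -
      have "continuous_on (cbox 0 1) ((\<lambda>(s, t). fx s t) \<circ> (\<lambda>t. (s, t)))"
        by (rule continuous_on_compose, intro continuous_intros, rule continuous_on_subset[OF contfx])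
           (use U(3) in auto)
      then show ?thesis by (simp add: o_def)
    qed
    then have "fx s integrable_on cbox 0 1"
      by (rule integrable_continuous)
    then have "blinfun_apply (integral (cbox 0 1) (fx s)) v = integral (cbox 0 1) (\<lambda>t. blinfun_apply (fx s t) v)"
      by (rule blinfun_apply_integral)
    also have "\<dots> = integral (cbox 0 1) (\<lambda>t. D s (\<gamma> t) v * \<gamma>' t)"
      by (rule integral_cong) (simp add: fx U)
    finally show ?thesis
      by (simp add: int)
  qed
  then have "blinfun_apply (integral (cbox 0 1) (fx s)) = (\<lambda>v. contour_integral \<gamma> (\<lambda>z. D s z v))"
    by blast
  ultimately show ?thesis
    unfolding at_within_open[OF U(3,2)] by (simp only: int flip: \<gamma>_def)
qed

lemma has_complex_derivative_circle_integral:
  fixes \<Phi> :: "complex ^ 'n::finite \<Rightarrow> complex \<Rightarrow> complex"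
  assumes U: "convex U" "open U" "s \<in> U"
    and der: "\<And>s z. s \<in> U \<Longrightarrow> z \<in> sphere 0 \<bar>R\<bar> \<Longrightarrow> has_complex_derivative (\<lambda>s. \<Phi> s z) (D s z) s"
    and contD: "\<And>v. continuous_on (U \<times> sphere 0 \<bar>R\<bar>) (\<lambda>(s, z). D s z v)"
    and cont\<Phi>: "\<And>s. s \<in> U \<Longrightarrow> continuous_on (sphere 0 \<bar>R\<bar>) (\<Phi> s)"
  shows "has_complex_derivative (\<lambda>s. contour_integral (circlepath 0 R) (\<Phi> s))
           (\<lambda>v. contour_integral (circlepath 0 R) (\<lambda>z. D s z v)) s"
  unfolding has_complex_derivative_def
proof (intro conjI allI)
  show "((\<lambda>s. contour_integral (circlepath 0 R) (\<Phi> s)) has_derivative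
          (\<lambda>v. contour_integral (circlepath 0 R) (\<lambda>z. D s z v))) (at s)"
    using der by (intro has_derivative_circle_integral[OF U _ contD cont\<Phi>])
                 (auto simp: has_complex_derivative_def)
  fix c v
  have "continuous_on (sphere 0 \<bar>R\<bar>) ((\<lambda>(s, z). D s z v) \<circ> Pair s)"
    by (rule continuous_on_compose, intro continuous_intros, rule continuous_on_subset[OF contD])
       (use U(3) in auto)
  then have "(\<lambda>z. D s z v) contour_integrable_on circlepath 0 R"
    by (intro contour_integrable_continuous_circlepath) (simp add: o_def)
  moreover have "contour_integral (circlepath 0 R) (\<lambda>z. D s z (c *s v)) =
                 contour_integral (circlepath 0 R) (\<lambda>z. c * D s z v)"
    by (rule contour_integral_eq) (use der[OF U(3)] in \<open>auto simp: has_complex_derivative_def\<close>)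
  ultimately show "contour_integral (circlepath 0 R) (\<lambda>z. D s z (c *s v)) =
                   c * contour_integral (circlepath 0 R) (\<lambda>z. D s z v)"
    by (simp add: contour_integral_lmul)
qed

section \<open>Circle integrals over quotients by a polynomial\<close>

text \<open>
  The right-hand side does not mention the radius; this independence is what makes the limit of large
  radii usable below.
\<close>

lemma circle_integral_over_poly:
  assumes "p \<noteq> 0" "R > 0" "\<And>z. poly p z = 0 \<Longrightarrow> norm z < R" "\<phi> holomorphic_on UNIV"
  shows "contour_integral (circlepath 0 R) (\<lambda>z. \<phi> z / poly p z) =
           2 * pi * \<i> * (\<Sum>x | poly p x = 0. residue (\<lambda>z. \<phi> z / poly p z) x)"
proof -
  have "contour_integral (circlepath 0 R) (\<lambda>z. \<phi> z / poly p z) =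
          2 * pi * \<i> * (\<Sum>x | poly p x = 0. winding_number (circlepath 0 R) x * residue (\<lambda>z. \<phi> z / poly p z) x)"
  proof (rule Residue_theorem[of UNIV])
    show "(\<lambda>z. \<phi> z / poly p z) holomorphic_on UNIV - {x. poly p x = 0}"
      using assms(4) by (auto intro!: holomorphic_intros intro: holomorphic_on_subset)
  qed (use assms(1,2) in \<open>auto simp: poly_roots_finite dest: assms(3)\<close>)
  also have "(\<Sum>x | poly p x = 0. winding_number (circlepath 0 R) x * residue (\<lambda>z. \<phi> z / poly p z) x) =
             (\<Sum>x | poly p x = 0. residue (\<lambda>z. \<phi> z / poly p z) x)"
    by (intro sum.cong refl) (use assms(3) in \<open>auto simp: winding_number_circlepath\<close>)
  finally show ?thesis .
qed

text \<open>
  At a simple root, \<open>(z - x) / p(z)\<close> is the reciprocal of a difference quotient of \<open>p\<close>.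
\<close>

lemma residue_over_poly_simple_root:
  assumes "\<phi> holomorphic_on UNIV" "p \<noteq> 0" "poly p x = 0" "poly (pderiv p) x \<noteq> 0"
  shows "residue (\<lambda>z. \<phi> z / poly p z) x = \<phi> x / poly (pderiv p) x"
proof (rule residue_simple'[of "UNIV - ({z. poly p z = 0} - {x})"])
  show "open (UNIV - ({z. poly p z = 0} - {x}))"
    using poly_roots_finite[OF assms(2)] by (intro open_Diff finite_imp_closed) auto
  show "(\<lambda>z. \<phi> z / poly p z) holomorphic_on UNIV - ({z. poly p z = 0} - {x}) - {x}"
    using assms(1) by (auto intro!: holomorphic_intros intro: holomorphic_on_subset)
  have "((\<lambda>w. (poly p w - poly p x) / (w - x)) \<longlongrightarrow> poly (pderiv p) x) (at x)"
    using poly_DERIV[of p x] by (simp only: has_field_derivative_iff)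
  moreover have "(\<phi> \<longlongrightarrow> \<phi> x) (at x)"
    using holomorphic_on_imp_continuous_on[OF assms(1)] by (simp add: continuous_on_def)
  ultimately have "((\<lambda>w. \<phi> w / ((poly p w - poly p x) / (w - x))) \<longlongrightarrow> \<phi> x / poly (pderiv p) x) (at x)"
    by (intro tendsto_divide assms(4))
  then show "((\<lambda>w. \<phi> w / poly p w * (w - x)) \<longlongrightarrow> \<phi> x / poly (pderiv p) x) (at x)"
    by (simp add: assms(3))
qed (use assms in auto)

text \<open>
  There is no residue at infinity: the integrand is \<open>o(1 / \<bar>z\<bar>)\<close>, so that the integral tends to
  \<open>0\<close> as the radius grows, and it does not depend on the radius.
\<close>

lemma circle_integral_poly_fraction_0:
  assumes "degree q + 2 \<le> degree p" "R > 0" "\<And>z. poly p z = 0 \<Longrightarrow> norm z < R"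
  shows "contour_integral (circlepath 0 R) (\<lambda>z. poly q z / poly p z) = (0::complex)"
proof -
  let ?I = "\<lambda>R. contour_integral (circlepath 0 R) (\<lambda>z. poly q z / poly p z)"
  have "p \<noteq> 0"
    using assms(1) by auto
  have indep: "?I S = ?I R" if "S \<ge> R" for S
    using that assms(2) 
    by (simp add: circle_integral_over_poly[OF \<open>p \<noteq> 0\<close> _ less_le_trans[OF assms(3) that]]
                  circle_integral_over_poly[OF \<open>p \<noteq> 0\<close> _ assms(3)] holomorphic_intros)
  have "norm (?I R) \<le> \<epsilon>" if "\<epsilon> > 0" for \<epsilon>
  proof -
    (* pCons 0 q is z * q(z): the extra factor z pays for the length of the circle. *)
    have "degree (pCons 0 q) < degree p"
      using assms(1) degree_pCons_le[of 0 q] by linarith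
    then have "((\<lambda>z. poly (pCons 0 q) z / poly p z) \<longlongrightarrow> 0) at_infinity"
      by (rule poly_divide_tendsto_0_at_infinity)
    moreover have "\<epsilon> / (2 * pi) > 0"
      using that by simp
    ultimately have "\<forall>\<^sub>F z in at_infinity. norm (poly (pCons 0 q) z / poly p z) < \<epsilon> / (2 * pi)"
      by (auto dest!: tendstoD simp: dist_norm)
    then obtain b where b: "\<And>z. norm z \<ge> b \<Longrightarrow> norm (poly (pCons 0 q) z / poly p z) < \<epsilon> / (2 * pi)"
      by (auto simp: eventually_at_infinity)
    (* S is large enough both for the smallness of the integrand and to enclose the roots. *)
    define S where "S = max b R"
    have S: "S > 0" "S \<ge> R" "S \<ge> b"
      using assms(2) by (auto simp: S_def)
    have "norm (?I S) \<le> \<epsilon> / (2 * pi) / S * (2 * pi * S)"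
    proof (rule has_contour_integral_bound_circlepath)
      have "continuous_on (sphere 0 \<bar>S\<bar>) (\<lambda>z. poly q z / poly p z)"
        using S less_le_trans[OF assms(3) S(2)] by (intro continuous_intros) force
      then show "((\<lambda>z. poly q z / poly p z) has_contour_integral ?I S) (circlepath 0 S)"
        by (intro has_contour_integral_integral contour_integrable_continuous_circlepath) simp
      fix z :: complex assume z: "norm (z - 0) = S"
      show "norm (poly q z / poly p z) \<le> \<epsilon> / (2 * pi) / S"
        using b[of z] S z by (simp add: norm_mult norm_divide field_simps)
    qed (use S that in auto)
    then show ?thesis
      using S(1) by (simp add: indep[OF S(2)])
  qed
  then have "norm (?I R) \<le> 0"
    by (rule field_le_epsilon) simp
  then show ?thesis by simp
qed

text \<open>
  The logarithmic derivative of a product of linear factors is the sum of the \<open>1 / (z - x)\<close>, to each of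
  which the Cauchy integral formula applies. Working with a multiset of roots takes care of the
  multiplicities.
\<close>

lemma circle_integral_log_derivative:
  assumes "f holomorphic_on UNIV" "\<And>x. x \<in># A \<Longrightarrow> norm x < R"
  shows "((\<lambda>z. f z * poly (pderiv (\<Prod>x\<in>#A. [:-x, 1:])) z / poly (\<Prod>x\<in>#A. [:-x, 1:]) z)
           has_contour_integral 2 * pi * \<i> * (\<Sum>x\<in>#A. f x)) (circlepath 0 R)"
  using assms(2)
proof (induction A)
  case (add x A)
  let ?p = "\<Prod>x\<in>#A. [:-x, 1:]"
  have "((\<lambda>z. f z / (z - x)) has_contour_integral 2 * pi * \<i> * f x) (circlepath 0 R)"
    using Cauchy_integral_circlepath_simple[OF holomorphic_on_subset[OF assms(1)], of 0 R x] add.prems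
    by simp
  moreover have "((\<lambda>z. f z * poly (pderiv ?p) z / poly ?p z) has_contour_integral 2 * pi * \<i> * (\<Sum>x\<in>#A. f x)) (circlepath 0 R)"
    by (rule add.IH) (use add.prems in auto)
  ultimately have "((\<lambda>z. f z / (z - x) + f z * poly (pderiv ?p) z / poly ?p z) has_contour_integral
      2 * pi * \<i> * f x + 2 * pi * \<i> * (\<Sum>x\<in>#A. f x)) (circlepath 0 R)"
    by (rule has_contour_integral_add)
  then have "((\<lambda>z. f z / (z - x) + f z * poly (pderiv ?p) z / poly ?p z) has_contour_integral
      2 * pi * \<i> * (\<Sum>x\<in>#add_mset x A. f x)) (circlepath 0 R)"
    by (simp add: distrib_left)
  then show ?case
  proof (rule has_contour_integral_eq)
    fix z assume "z \<in> path_image (circlepath 0 R)"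
    then have z: "norm z = \<bar>R\<bar>"
      by simp
    then have "z \<noteq> x" and "poly ?p z \<noteq> 0"
      using add.prems by (force simp: poly_prod_mset prod_mset_zero_iff)+
    moreover have "poly (\<Prod>x\<in>#add_mset x A. [:-x, 1:]) z = (z - x) * poly ?p z"
      by (simp add: algebra_simps)
    moreover have "poly (pderiv (\<Prod>x\<in>#add_mset x A. [:-x, 1:])) z = poly ?p z + (z - x) * poly (pderiv ?p) z"
      by (simp add: pderiv_mult pderiv_pCons del: mult_pCons_left)
    ultimately show "f z / (z - x) + f z * poly (pderiv ?p) z / poly ?p z =
      f z * poly (pderiv (\<Prod>x\<in>#add_mset x A. [:-x, 1:])) z / poly (\<Prod>x\<in>#add_mset x A. [:-x, 1:]) z"
      using \<open>z \<noteq> x\<close> \<open>poly ?p z \<noteq> 0\<close> by (simp only: distrib_left add_divide_distrib mult.left_commute) simp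
  qed
qed (simp add: has_contour_integral_0)

text \<open>
  Splitting off a Taylor polynomial, one removable singularity \<open>(g\<^sub>1 z - g\<^sub>1 0) / z\<close> at a time.
\<close>

lemma entire_division_with_remainder:
  assumes "g holomorphic_on UNIV"
  shows "\<exists>g1 q. g1 holomorphic_on UNIV \<and> (q = 0 \<or> degree q < d) \<and> (\<forall>z. g z = z ^ d * g1 z + poly q z)"
proof (induction d)
  case 0
  then show ?case
    using assms by (intro exI[of _ g] exI[of _ 0]) auto
next
  case (Suc d)
  then obtain g1 q where IH: "g1 holomorphic_on UNIV" "q = 0 \<or> degree q < d"
    "\<And>z. g z = z ^ d * g1 z + poly q z" by blast
  (* the default value at 0 is the one that fills the removable singularity *)
  define g2 where "g2 = (\<lambda>z. if z = 0 then deriv g1 0 else (g1 z - g1 0) / (z - 0))"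
  have "g2 holomorphic_on UNIV"
    unfolding g2_def by (rule pole_lemma_open[OF IH(1)]) auto
  moreover have "degree (q + monom (g1 0) d) < Suc d"
    using IH(2) degree_monom_le[of "g1 0" d] by (intro le_imp_less_Suc degree_add_le) auto
  moreover have "g z = z ^ Suc d * g2 z + poly (q + monom (g1 0) d) z" for z
    by (simp add: IH(3) g2_def poly_monom algebra_simps)
  ultimately show ?case
    by blast
qed

section \<open>Simple roots and the discriminant\<close>

text \<open>
  The resultant of \<open>p\<close> and \<open>p'\<close> vanishes only if they have a common factor, hence a common root.
\<close>

lemma discriminant_nonzero_if_simple_roots:
  assumes "p \<noteq> 0" "\<And>x. poly p x = 0 \<Longrightarrow> poly (pderiv p) x \<noteq> (0::complex)"
  shows "discriminant p \<noteq> 0"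
proof -
  have "degree (gcd p (pderiv p)) = 0"
  proof (rule ccontr)
    assume "degree (gcd p (pderiv p)) \<noteq> 0"
    then obtain x where "poly (gcd p (pderiv p)) x = 0"
      using fundamental_theorem_of_algebra[of "gcd p (pderiv p)"] by (auto simp: constant_degree)
    then have "[:-x, 1:] dvd gcd p (pderiv p)"
      by (simp add: poly_eq_0_iff_dvd)
    then have "[:-x, 1:] dvd p" "[:-x, 1:] dvd pderiv p"
      by (meson dvd_trans gcd_dvd1 gcd_dvd2)+
    then show False
      using assms(2)[of x] by (simp add: poly_eq_0_iff_dvd)
  qed
  then have "resultant p (pderiv p) \<noteq> 0"
    by (simp add: resultant_0_gcd)
  then show ?thesis
    using assms(1) by (simp add: discriminant_def)
qed

lemma proots_simple_roots:
  assumes "p \<noteq> 0" "\<And>x. poly p x = 0 \<Longrightarrow> poly (pderiv p) x \<noteq> (0::complex)"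
  shows "proots p = mset_set {x. poly p x = 0}"
proof (rule multiset_eqI)
  fix x
  have "rsquarefree p"
    using assms(2) by (auto simp: rsquarefree_roots)
  then show "count (proots p) x = count (mset_set {x. poly p x = 0}) x"
    using rsquarefree_root_order[of p x] assms(1) poly_roots_finite[of p]
    by (cases "poly p x = 0") (auto simp: order_0I)
qed

lemma eventually_not_in_finite_at:
  fixes x :: "'a::t1_space"
  assumes "finite B"
  shows "\<forall>\<^sub>F t in at x. t \<notin> B"
  unfolding eventually_at_topological
proof (intro exI conjI ballI impI)
  show "open (- (B - {x}))"
    using assms by (intro open_Compl finite_imp_closed) auto
qed auto

section \<open>The polynomial \<open>P\<^sub>\<sigma>\<close> as a function of its coefficients\<close>

locale labelled_coordinates =
  fixes k :: nat and \<iota> :: "nat \<Rightarrow> 'n::finite"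
  assumes k: "k \<ge> 1" and \<iota>: "bij_betw \<iota> {1..k} (UNIV :: 'n set)"
begin

abbreviation P :: "complex ^ 'n \<Rightarrow> complex poly" where "P \<equiv> sigma_poly k \<iota>"

text \<open>
  \<open>L \<sigma>\<close> is the part of \<open>P \<sigma>\<close> below the leading term. It is linear in \<open>\<sigma>\<close>, and therefore \<open>L v\<close> is also
  the derivative of \<open>P\<close> in the direction \<open>v\<close>.
\<close>

definition L :: "complex ^ 'n \<Rightarrow> complex poly" where
  "L v = (\<Sum>h = 1..k. monom ((-1) ^ h * v $ \<iota> h) (k - h))"

lemma P_eq: "P \<sigma> = monom 1 k + L \<sigma>"
  by (simp add: sigma_poly_def L_def)

lemma poly_L: "poly (L v) z = (\<Sum>h = 1..k. (-1) ^ h * v $ \<iota> h * z ^ (k - h))"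
  by (simp add: L_def poly_sum poly_monom)

lemma poly_pderiv_L:
  "poly (pderiv (L v)) z = (\<Sum>h = 1..k. of_nat (k - h) * ((-1) ^ h * v $ \<iota> h) * z ^ (k - h - 1))"
  by (simp add: L_def pderiv_sum poly_sum pderiv_monom poly_monom)

lemma L_add: "L (u + v) = L u + L v"
  by (simp add: L_def distrib_left flip: sum.distrib add_monom)

lemma L_scale: "L (c *s v) = Polynomial.smult c (L v)"
  by (simp add: L_def smult_sum2 smult_monom mult.left_commute)

lemma L_scaleR: "L (r *\<^sub>R v) = Polynomial.smult (of_real r) (L v)"
  unfolding L_scale[symmetric] by (rule arg_cong[of _ _ L]) (simp add: Finite_Cartesian_Product.vec_eq_iff scaleR_conv_of_real[where 'a = complex])

lemma L_axis:
  assumes "h \<in> {1..k}"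
  shows "L (axis (\<iota> h) 1) = monom ((-1) ^ h) (k - h)"
proof -
  have "L (axis (\<iota> h) 1) = (\<Sum>j = 1..k. if j = h then monom ((-1) ^ h) (k - h) else 0)"
    unfolding L_def
    by (intro sum.cong refl)
       (use \<iota> assms in \<open>auto simp: axis_def bij_betw_def inj_on_eq_iff\<close>)
  then show ?thesis
    using assms by simp
qed

lemma P_add: "P (\<sigma> + v) = P \<sigma> + L v"
  by (simp add: P_eq L_add)

lemma degree_L: "degree (L v) < k"
  unfolding L_def
  by (intro le_less_trans[OF degree_sum_le[where n = "k - 1"]])
     (use k in \<open>auto intro: order_trans[OF degree_monom_le]\<close>)

lemma degree_P [simp]: "degree (P \<sigma>) = k"
  using degree_L[of \<sigma>] by (simp add: P_eq degree_add_eq_left degree_monom_eq)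

lemma lead_coeff_P [simp]: "lead_coeff (P \<sigma>) = 1"
  using coeff_eq_0[OF degree_L, of \<sigma>] unfolding degree_P by (simp add: P_eq)

lemma P_nonzero [simp]: "P \<sigma> \<noteq> 0"
  using lead_coeff_P[of \<sigma>] by force

text \<open>
  A Cauchy bound on the roots: outside this radius the leading term dominates the \<open>k\<close> others, each of
  which is at most \<open>M \<bar>z\<bar>^(k-1)\<close>.
\<close>

lemma poly_P_nonzero:
  assumes "norm \<sigma> < M" "norm z \<ge> real k * M + 1"
  shows "poly (P \<sigma>) z \<noteq> 0"
proof
  assume "poly (P \<sigma>) z = 0"
  then have eq: "z ^ k = - (\<Sum>h = 1..k. (-1) ^ h * \<sigma> $ \<iota> h * z ^ (k - h))"
    by (simp add: P_eq poly_monom poly_L eq_neg_iff_add_eq_0)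
  have M: "M > 0"
    using assms(1) norm_ge_zero[of \<sigma>] by linarith
  then have "0 \<le> real k * M"
    by simp
  then have z: "norm z \<ge> 1"
    using assms(2) by linarith
  have "norm z ^ k \<le> (\<Sum>h = 1..k. M * norm z ^ (k - 1))"
    unfolding norm_power[symmetric] eq norm_minus_cancel
  proof (rule sum_norm_le)
    fix h assume h: "h \<in> {1..k}"
    have "norm (\<sigma> $ \<iota> h) * norm z ^ (k - h) \<le> M * norm z ^ (k - 1)"
      using h z M assms(1) Finite_Cartesian_Product.norm_nth_le[of \<sigma> "\<iota> h"]
      by (intro mult_mono power_increasing) auto
    then show "norm ((-1) ^ h * \<sigma> $ \<iota> h * z ^ (k - h)) \<le> M * norm (z ^ (k - 1))"
      by (simp add: norm_mult norm_power)
  qed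
  also have "\<dots> = real k * M * norm z ^ (k - 1)"
    by simp
  also have "\<dots> < norm z * norm z ^ (k - 1)"
    using assms(2) z by (intro mult_strict_right_mono zero_less_power) auto
  also have "\<dots> = norm z ^ k"
    using k by (simp flip: power_Suc)
  finally show False by simp
qed

lemma has_complex_derivative_poly_P:
  "has_complex_derivative (\<lambda>\<sigma>. poly (P \<sigma>) z) (\<lambda>v. poly (L v) z) \<sigma>"
proof -
  have "bounded_linear (\<lambda>v. poly (L v) z)"
    by (rule linear_conv_bounded_linear[THEN iffD1], rule linearI)
       (simp_all add: L_add L_scaleR scaleR_conv_of_real[where 'a = complex])
  then have "((\<lambda>\<sigma>. poly (monom 1 k) z + poly (L \<sigma>) z) has_derivative (\<lambda>v. 0 + poly (L v) z)) (at \<sigma>)"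
    by (intro has_derivative_add has_derivative_const bounded_linear_imp_has_derivative)
  then show ?thesis
    by (simp add: has_complex_derivative_def P_eq L_scale)
qed

lemma has_complex_derivative_poly_pderiv_P:
  "has_complex_derivative (\<lambda>\<sigma>. poly (pderiv (P \<sigma>)) z) (\<lambda>v. poly (pderiv (L v)) z) \<sigma>"
proof -
  have "bounded_linear (\<lambda>v. poly (pderiv (L v)) z)"
    by (rule linear_conv_bounded_linear[THEN iffD1], rule linearI)
       (simp_all add: L_add L_scaleR scaleR_conv_of_real[where 'a = complex] pderiv_add pderiv_smult)
  then have "((\<lambda>\<sigma>. poly (pderiv (monom 1 k)) z + poly (pderiv (L \<sigma>)) z) has_derivative (\<lambda>v. 0 + poly (pderiv (L v)) z)) (at \<sigma>)"
    by (intro has_derivative_add has_derivative_const bounded_linear_imp_has_derivative)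
  then show ?thesis
    by (simp add: has_complex_derivative_def P_eq L_scale pderiv_add pderiv_smult)
qed

lemma continuous_on_poly_P:
  "continuous_on A (\<lambda>x. poly (P (fst x)) (snd x))"
  "continuous_on A (\<lambda>x. poly (pderiv (P (fst x))) (snd x))"
  unfolding P_eq poly_add pderiv_add poly_L poly_pderiv_L
  by (intro continuous_intros)+

section \<open>The normalised circle integrals\<close>

lemma radius_pos:
  assumes "norm (\<sigma> :: complex ^ 'n) < M"
  shows "real k * M + 1 > 0"
proof -
  have "M > 0"
    using assms norm_ge_zero[of \<sigma>] by linarith
  then have "0 \<le> real k * M"
    by simp
  then show ?thesis
    by linarith
qed

lemma roots_inside_circle:
  assumes "norm \<sigma> < M" "poly (P \<sigma>) z = 0"
  shows "norm z < real k * M + 1"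
  using poly_P_nonzero[OF assms(1), of z] assms(2) by linarith

text \<open>
  The integral \<open>(1 / 2\<pi>\<i>) \<integral> \<phi> / P\<^sub>\<sigma>^n\<close> over a circle that encloses the roots of \<open>P\<^sub>\<sigma>\<close> for all \<open>\<sigma>\<close>
  in the ball of radius \<open>M\<close>. The exponent is kept separate because differentiation in \<open>\<sigma>\<close> raises it
  by one and multiplies the numerator by a polynomial, so that the family is closed under \<open>\<partial>\<^sub>h\<close>.
\<close>

definition J :: "real \<Rightarrow> (complex \<Rightarrow> complex) \<Rightarrow> nat \<Rightarrow> complex ^ 'n \<Rightarrow> complex" where
  "J M \<phi> n \<sigma> =
     contour_integral (circlepath 0 (real k * M + 1)) (\<lambda>z. \<phi> z / poly (P \<sigma>) z ^ n) / (2 * pi * \<i>)"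

lemma poly_P_nonzero_on_circle:
  assumes "norm \<sigma> < M" "z \<in> sphere 0 \<bar>real k * M + 1\<bar>"
  shows "poly (P \<sigma>) z \<noteq> 0"
  using poly_P_nonzero[OF assms(1)] assms(2) by simp

lemma continuous_on_J_integrand:
  assumes "norm \<sigma> < M" "continuous_on UNIV \<phi>"
  shows "continuous_on (sphere 0 \<bar>real k * M + 1\<bar>) (\<lambda>z. \<phi> z / poly (P \<sigma>) z ^ n)"
  using assms poly_P_nonzero_on_circle[OF assms(1)]
  by (auto intro!: continuous_intros intro: continuous_on_subset)

lemma J_integrable:
  assumes "norm \<sigma> < M" "continuous_on UNIV \<phi>"
  shows "(\<lambda>z. \<phi> z / poly (P \<sigma>) z ^ n) contour_integrable_on circlepath 0 (real k * M + 1)"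
  using continuous_on_J_integrand[OF assms] by (intro contour_integrable_continuous_circlepath) simp

lemma J_cong:
  assumes "norm \<sigma> < M"
    "\<And>z. poly (P \<sigma>) z \<noteq> 0 \<Longrightarrow> \<phi> z / poly (P \<sigma>) z ^ n = \<psi> z / poly (P \<sigma>) z ^ m"
  shows "J M \<phi> n \<sigma> = J M \<psi> m \<sigma>"
  unfolding J_def
  by (intro arg_cong2[where f = "(/)"] contour_integral_eq refl assms(2) poly_P_nonzero_on_circle[OF assms(1)])
     simp

lemma J_0: "J M (\<lambda>z. 0) n \<sigma> = 0"
  by (simp add: J_def)

lemma J_add:
  assumes "norm \<sigma> < M" "continuous_on UNIV \<phi>" "continuous_on UNIV \<psi>"
  shows "J M (\<lambda>z. \<phi> z + \<psi> z) n \<sigma> = J M \<phi> n \<sigma> + J M \<psi> n \<sigma>"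
  unfolding J_def add_divide_distrib
  by (subst contour_integral_add) (simp_all add: J_integrable assms add_divide_distrib)

lemma J_cmult:
  assumes "norm \<sigma> < M" "continuous_on UNIV \<phi>"
  shows "J M (\<lambda>z. c * \<phi> z) n \<sigma> = c * J M \<phi> n \<sigma>"
  using contour_integral_lmul[OF J_integrable[OF assms], of c n] by (simp add: J_def)

lemma J_sum:
  assumes "norm \<sigma> < M" "finite A" "\<And>a. a \<in> A \<Longrightarrow> continuous_on UNIV (\<phi> a)"
  shows "J M (\<lambda>z. \<Sum>a\<in>A. \<phi> a z) n \<sigma> = (\<Sum>a\<in>A. J M (\<phi> a) n \<sigma>)"
  using assms(2,3)
  by induction (simp_all add: J_0 J_add assms(1) continuous_on_sum)

lemma has_complex_derivative_J:
  assumes "norm \<sigma> < M" "continuous_on UNIV \<phi>"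
  shows "has_complex_derivative (J M \<phi> n) (\<lambda>v. J M (\<lambda>z. - of_nat n * poly (L v) z * \<phi> z) (Suc n) \<sigma>) \<sigma>"
proof -
  let ?R = "real k * M + 1"
  let ?D = "\<lambda>\<sigma> z v. (- of_nat n * \<phi> z / poly (P \<sigma>) z ^ Suc n) * poly (L v) z"
  have "has_complex_derivative
          (\<lambda>\<sigma>. contour_integral (circlepath 0 ?R) (\<lambda>z. \<phi> z / poly (P \<sigma>) z ^ n))
          (\<lambda>v. contour_integral (circlepath 0 ?R) (\<lambda>z. ?D \<sigma> z v)) \<sigma>"
  proof (rule has_complex_derivative_circle_integral)
    show "convex (ball 0 M :: (complex ^ 'n) set)" "open (ball 0 M :: (complex ^ 'n) set)"
         "\<sigma> \<in> ball 0 M"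
      using assms(1) by auto
    show "has_complex_derivative (\<lambda>\<sigma>. \<phi> z / poly (P \<sigma>) z ^ n) (?D \<sigma> z) \<sigma>"
      if "\<sigma> \<in> ball 0 M" "z \<in> sphere 0 \<bar>?R\<bar>" for \<sigma> z
      using that poly_P_nonzero_on_circle[of \<sigma> M z]
      by (intro has_complex_derivative_compose[OF has_complex_derivative_poly_P]
                has_field_derivative_const_over_power) auto
    show "continuous_on (ball 0 M \<times> sphere 0 \<bar>?R\<bar>) (\<lambda>(\<sigma>, z). ?D \<sigma> z v)" for v
      unfolding case_prod_beta using poly_P_nonzero_on_circle[of _ M]
      by (intro continuous_intros continuous_on_poly_P continuous_on_compose2[OF assms(2)]) auto
    show "continuous_on (sphere 0 \<bar>?R\<bar>) (\<lambda>z. \<phi> z / poly (P \<sigma>) z ^ n)" if "\<sigma> \<in> ball 0 M" for \<sigma>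
      using that assms(2) by (intro continuous_on_J_integrand) auto
  qed
  moreover have "((\<lambda>w. w / (2 * pi * \<i>)) has_field_derivative 1 / (2 * pi * \<i>)) (at w)" for w
    by (auto intro!: derivative_eq_intros)
  ultimately have "has_complex_derivative (J M \<phi> n)
      (\<lambda>v. 1 / (2 * pi * \<i>) * contour_integral (circlepath 0 ?R) (\<lambda>z. ?D \<sigma> z v)) \<sigma>"
    unfolding J_def[abs_def] by (rule has_complex_derivative_compose)
  then show ?thesis
    by (simp add: J_def mult_ac)
qed

lemma pdiff_J:
  assumes "norm \<sigma> < M" "continuous_on UNIV \<phi>" "h \<in> {1..k}"
  shows "pdiff \<iota> h (J M \<phi> n) \<sigma> = J M (\<lambda>z. - of_nat n * (-1) ^ h * z ^ (k - h) * \<phi> z) (Suc n) \<sigma>"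
  using pdiff_eq_derivative_axis[OF has_complex_derivative_J[OF assms(1,2)], of \<iota> h n]
  by (simp add: L_axis[OF assms(3)] poly_monom mult.assoc)

section \<open>The integral representation of trace forms\<close>

text \<open>
  Moving \<open>\<sigma>\<^sub>k\<close> only shifts \<open>P \<sigma>\<close> by a constant and leaves its derivative unchanged. A multiple root then
  means that the constant is the negative of one of the finitely many critical values.
\<close>

lemma eventually_simple_roots:
  "\<forall>\<^sub>F t in at 0. \<forall>x. poly (P (\<sigma> + t *s axis (\<iota> k) 1)) x = 0 \<longrightarrow>
       poly (pderiv (P (\<sigma> + t *s axis (\<iota> k) 1))) x \<noteq> 0"
proof -
  (* the finitely many t for which the shifted polynomial has a multiple root *)
  let ?B = "(\<lambda>x. - ((-1) ^ k * poly (P \<sigma>) x)) ` {x. poly (pderiv (P \<sigma>)) x = 0}"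
  have P_shift: "P (\<sigma> + t *s axis (\<iota> k) 1) = P \<sigma> + [:(-1) ^ k * t:]" for t
    using k by (simp add: P_add L_scale L_axis monom_0 mult.commute)
  have "pderiv (P \<sigma>) \<noteq> 0"
    using k by (simp add: pderiv_eq_0_iff)
  then have "finite ?B"
    using poly_roots_finite by blast
  then have "\<forall>\<^sub>F t in at 0. t \<notin> ?B"
    by (rule eventually_not_in_finite_at)
  then show ?thesis
  proof eventually_elim
    case (elim t)
    have "t = - ((-1) ^ k * poly (P \<sigma>) x)" if "poly (P \<sigma>) x + (-1) ^ k * t = 0" for x
    proof -
      have "(-1) ^ k * (poly (P \<sigma>) x + (-1) ^ k * t) = 0"
        using that by simp
      then show ?thesis
        by (simp add: distrib_left flip: mult.assoc power_add mult_2) (simp add: add_eq_0_iff)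
    qed
    then show ?case
      using elim unfolding P_shift by (auto simp: pderiv_add pderiv_pCons)
  qed
qed

text \<open>
  Where the roots are simple, both sides are the sum of the same residues. Such points accumulate at
  every \<open>\<sigma>\<close> along the last coordinate axis, and both sides are continuous.
\<close>

lemma trace_form_eq_J:
  assumes "entire G" "g holomorphic_on UNIV"
    and G: "\<And>\<sigma>. discriminant (P \<sigma>) \<noteq> 0 \<Longrightarrow>
              G \<sigma> = (\<Sum>x\<in>#proots (P \<sigma>). g x / poly (pderiv (P \<sigma>)) x)"
    and "norm \<sigma> < M"
  shows "G \<sigma> = J M g 1 \<sigma>"
proof (rule tendsto_unique)
  let ?\<gamma> = "\<lambda>t. \<sigma> + t *s axis (\<iota> k) 1"
  have "continuous_on UNIV ?\<gamma>"
    unfolding vector_scalar_mult_def by (intro continuous_intros)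
  then have "isCont ?\<gamma> 0"
    by (simp add: continuous_on_eq_continuous_at)
  then have \<gamma>: "(?\<gamma> \<longlongrightarrow> \<sigma>) (at 0)"
    by (simp add: isCont_def)
  have g: "continuous_on UNIV g"
    using assms(2) by (rule holomorphic_on_imp_continuous_on)
  have "isCont G \<sigma>" "isCont (J M g 1) \<sigma>"
    using assms(1) has_complex_derivative_J[OF assms(4) g]
    unfolding entire_def has_complex_derivative_def by (blast intro: has_derivative_continuous)+
  then show "((\<lambda>t. G (?\<gamma> t)) \<longlongrightarrow> G \<sigma>) (at 0)"
    and "((\<lambda>t. G (?\<gamma> t)) \<longlongrightarrow> J M g 1 \<sigma>) (at 0)"
  proof -
    assume cont: "isCont G \<sigma>" "isCont (J M g 1) \<sigma>"
    show "((\<lambda>t. G (?\<gamma> t)) \<longlongrightarrow> G \<sigma>) (at 0)"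
      by (rule isCont_tendsto_compose[OF cont(1) \<gamma>])
    have "((\<lambda>t. norm (?\<gamma> t)) \<longlongrightarrow> norm \<sigma>) (at 0)"
      by (intro tendsto_norm \<gamma>)
    then have "\<forall>\<^sub>F t in at 0. norm (?\<gamma> t) < M"
      using assms(4) by (rule order_tendstoD)
    with eventually_simple_roots[of \<sigma>] have "\<forall>\<^sub>F t in at 0. J M g 1 (?\<gamma> t) = G (?\<gamma> t)"
    proof eventually_elim
      case (elim t)
      let ?p = "P (?\<gamma> t)"
      have "contour_integral (circlepath 0 (real k * M + 1)) (\<lambda>z. g z / poly ?p z) =
              2 * pi * \<i> * (\<Sum>x | poly ?p x = 0. residue (\<lambda>z. g z / poly ?p z) x)"
        by (intro circle_integral_over_poly radius_pos[OF elim(2)] roots_inside_circle[OF elim(2)] assms(2)) auto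
      also have "(\<Sum>x | poly ?p x = 0. residue (\<lambda>z. g z / poly ?p z) x) =
                 (\<Sum>x | poly ?p x = 0. g x / poly (pderiv ?p) x)"
        by (intro sum.cong refl residue_over_poly_simple_root assms(2)) (use elim(1) in auto)
      also have "\<dots> = (\<Sum>x\<in>#proots ?p. g x / poly (pderiv ?p) x)"
        using elim(1) by (simp add: proots_simple_roots sum_unfold_sum_mset)
      also have "\<dots> = G (?\<gamma> t)"
        using elim(1) by (intro G[symmetric] discriminant_nonzero_if_simple_roots) auto
      finally show ?case
        by (simp add: J_def)
    qed
    then show "((\<lambda>t. G (?\<gamma> t)) \<longlongrightarrow> J M g 1 \<sigma>) (at 0)"
      by (rule Lim_transform_eventually[OF isCont_tendsto_compose[OF cont(2) \<gamma>]])
  qed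
qed simp

section \<open>The differential systems\<close>

lemma J_second_derivative:
  assumes "norm \<sigma> < M" "continuous_on UNIV g" "p \<in> {1..k}" "q \<in> {1..k}"
  shows "pdiff \<iota> p (pdiff \<iota> q (J M g 1)) \<sigma> =
           J M (\<lambda>z. 2 * (-1) ^ (p + q) * z ^ (k - p + (k - q)) * g z) 3 \<sigma>"
proof -
  have "pdiff \<iota> p (pdiff \<iota> q (J M g 1)) \<sigma> =
          pdiff \<iota> p (J M (\<lambda>z. - of_nat 1 * (-1) ^ q * z ^ (k - q) * g z) (Suc 1)) \<sigma>"
    by (rule pdiff_cong[of "ball 0 M"]) (use assms in \<open>auto simp: pdiff_J[where n = 1, simplified]\<close>)
  also have "\<dots> = J M (\<lambda>z. - of_nat (Suc 1) * (-1) ^ p * z ^ (k - p) * (- of_nat 1 * (-1) ^ q * z ^ (k - q) * g z)) (Suc (Suc 1)) \<sigma>"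
    by (intro pdiff_J assms continuous_intros)
  also have "\<dots> = J M (\<lambda>z. 2 * (-1) ^ (p + q) * z ^ (k - p + (k - q)) * g z) 3 \<sigma>"
    by (rule arg_cong2[where f = "\<lambda>\<phi> n. J M \<phi> n \<sigma>"]) (auto simp: power_add mult_ac)
  finally show ?thesis .
qed

text \<open>
  All terms are brought over \<open>P\<^sub>\<sigma>\<^sup>3\<close>; the numerators then add up to
  \<open>2 (-1)^m z^(k-m) g (z^k + L \<sigma> - P \<sigma>) = 0\<close>.
\<close>

lemma J_T_op:
  assumes "norm \<sigma> < M" "continuous_on UNIV g" "m \<in> {2..k}"
  shows "T_op k \<iota> m (J M g 1) \<sigma> + pdiff \<iota> m (J M g 1) \<sigma> = 0"
proof -
  have m: "m \<in> {1..k}" "m - 1 \<in> {1..k}" "1 \<in> {1..k}" "1 + (m - 1) = m"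
    using assms(3) by auto
  let ?\<phi> = "\<lambda>p q z. 2 * (-1) ^ (p + q) * z ^ (k - p + (k - q)) * g z"
  let ?\<psi> = "\<lambda>z. - ((-1) ^ m) * z ^ (k - m) * g z"
  have cont: "continuous_on UNIV (?\<phi> p q)" "continuous_on UNIV ?\<psi>" for p q
    using assms(2) by (auto intro!: continuous_intros)
  have first: "pdiff \<iota> m (J M g 1) \<sigma> = J M (\<lambda>z. ?\<psi> z * poly (P \<sigma>) z) 3 \<sigma>"
  proof -
    have "pdiff \<iota> m (J M g 1) \<sigma> = J M ?\<psi> 2 \<sigma>"
      using pdiff_J[OF assms(1,2) m(1), of 1] by (simp add: numeral_2_eq_2)
    also have "\<dots> = J M (\<lambda>z. ?\<psi> z * poly (P \<sigma>) z) 3 \<sigma>"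
      by (rule J_cong[OF assms(1)]) (simp add: power2_eq_square power3_eq_cube)
    finally show ?thesis .
  qed
  have cont_P: "continuous_on UNIV (\<lambda>z. ?\<psi> z * poly (P \<sigma>) z)"
    by (intro continuous_on_mult cont continuous_intros)
  have cont_sum: "continuous_on UNIV (\<lambda>z. \<Sum>h = 1..k. \<sigma> $ \<iota> h * ?\<phi> h m z)"
    by (intro continuous_on_sum continuous_on_mult_left cont)
  have "(\<Sum>h = 1..k. \<sigma> $ \<iota> h * pdiff \<iota> h (pdiff \<iota> m (J M g 1)) \<sigma>) =
        (\<Sum>h = 1..k. \<sigma> $ \<iota> h * J M (?\<phi> h m) 3 \<sigma>)"
    by (intro sum.cong refl arg_cong2[where f = "(*)"] J_second_derivative assms(1,2) m(1))
  also have "\<dots> = (\<Sum>h = 1..k. J M (\<lambda>z. \<sigma> $ \<iota> h * ?\<phi> h m z) 3 \<sigma>)"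
    by (intro sum.cong refl J_cmult[symmetric] assms(1) cont)
  also have "\<dots> = J M (\<lambda>z. \<Sum>h = 1..k. \<sigma> $ \<iota> h * ?\<phi> h m z) 3 \<sigma>"
    by (intro J_sum[symmetric] assms(1) continuous_on_mult_left cont finite_atLeastAtMost)
  finally have euler: "(\<Sum>h = 1..k. \<sigma> $ \<iota> h * pdiff \<iota> h (pdiff \<iota> m (J M g 1)) \<sigma>) =
               J M (\<lambda>z. \<Sum>h = 1..k. \<sigma> $ \<iota> h * ?\<phi> h m z) 3 \<sigma>" .
  have "T_op k \<iota> m (J M g 1) \<sigma> + pdiff \<iota> m (J M g 1) \<sigma> =
          J M (\<lambda>z. ?\<phi> 1 (m - 1) z + (\<Sum>h = 1..k. \<sigma> $ \<iota> h * ?\<phi> h m z)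
                     + ?\<psi> z * poly (P \<sigma>) z + ?\<psi> z * poly (P \<sigma>) z) 3 \<sigma>"
    unfolding T_op_def euler first J_second_derivative[OF assms(1,2) m(3,2)]
    by (simp only: J_add[OF assms(1)] cont cont_sum cont_P continuous_on_add)
  also have "\<dots> = J M (\<lambda>z. 0) 3 \<sigma>"
  proof (rule arg_cong[where f = "\<lambda>\<phi>. J M \<phi> 3 \<sigma>"], rule ext)
    fix z
    let ?c = "2 * (-1) ^ m * z ^ (k - m) * g z"
    have "k - 1 + (k - (m - 1)) = (k - m) + k"
      using assms(3) by auto
    then have "?\<phi> 1 (m - 1) z = ?c * z ^ k"
      by (simp add: m(4) power_add del: One_nat_def)
    moreover have "(\<Sum>h = 1..k. \<sigma> $ \<iota> h * ?\<phi> h m z) = ?c * poly (L \<sigma>) z"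
      unfolding poly_L sum_distrib_left by (intro sum.cong refl) (simp only: power_add mult_ac)
    moreover have "poly (P \<sigma>) z = z ^ k + poly (L \<sigma>) z"
      by (simp add: P_eq poly_monom)
    ultimately show "?\<phi> 1 (m - 1) z + (\<Sum>h = 1..k. \<sigma> $ \<iota> h * ?\<phi> h m z)
                     + ?\<psi> z * poly (P \<sigma>) z + ?\<psi> z * poly (P \<sigma>) z = 0"
      by (simp only:) (simp add: algebra_simps)
  qed
  also have "\<dots> = 0"
    by (rule J_0)
  finally show ?thesis .
qed

section \<open>The derivative of a trace function\<close>

lemma trace_eq_circle_integral:
  assumes "f holomorphic_on UNIV" "norm \<sigma> < M"
  shows "(\<Sum>x\<in>#proots (P \<sigma>). f x) =
           contour_integral (circlepath 0 (real k * M + 1))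
             (\<lambda>z. f z * poly (pderiv (P \<sigma>)) z / poly (P \<sigma>) z) / (2 * pi * \<i>)"
proof -
  have "(\<Prod>x\<in>#proots (P \<sigma>). [:-x, 1:]) = P \<sigma>"
    using complex_poly_decompose_multiset[of "P \<sigma>"] lead_coeff_P[of \<sigma>] by (simp only: smult_1_left)
  then have "((\<lambda>z. f z * poly (pderiv (P \<sigma>)) z / poly (P \<sigma>) z) has_contour_integral
          2 * pi * \<i> * (\<Sum>x\<in>#proots (P \<sigma>). f x)) (circlepath 0 (real k * M + 1))"
    using circle_integral_log_derivative[OF assms(1), of "proots (P \<sigma>)" "real k * M + 1"]
          roots_inside_circle[OF assms(2)] by simp
  then show ?thesis
    by (subst contour_integral_unique) (assumption, rule nonzero_mult_div_cancel_left[symmetric], simp)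
qed

text \<open>
  The derivative of \<open>f P\<^sub>\<sigma>' / P\<^sub>\<sigma>\<close> in the direction \<open>v\<close> differs from \<open>- f' L v / P\<^sub>\<sigma>\<close> by the \<open>z\<close>-derivative
  of \<open>f L v / P\<^sub>\<sigma>\<close>, whose integral over a closed path vanishes.
\<close>

lemma circle_integral_by_parts:
  assumes "f holomorphic_on UNIV" "norm \<sigma> < M"
  shows "contour_integral (circlepath 0 (real k * M + 1))
           (\<lambda>z. f z * poly (pderiv (P \<sigma>)) z * (- poly (L v) z / poly (P \<sigma>) z ^ 2)
                 + f z * poly (pderiv (L v)) z / poly (P \<sigma>) z) / (2 * pi * \<i>) =
         J M (\<lambda>z. - deriv f z * poly (L v) z) 1 \<sigma>" (is "contour_integral ?C ?D / _ = _")
proof -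
  let ?H = "\<lambda>z. - deriv f z * poly (L v) z / poly (P \<sigma>) z ^ 1"
  have "((\<lambda>z. ?D z - ?H z) has_contour_integral
          f (pathfinish ?C) * poly (L v) (pathfinish ?C) / poly (P \<sigma>) (pathfinish ?C) -
          f (pathstart ?C) * poly (L v) (pathstart ?C) / poly (P \<sigma>) (pathstart ?C)) ?C"
  proof (rule contour_integral_primitive)
    show "path_image ?C \<subseteq> {z. poly (P \<sigma>) z \<noteq> 0}"
      using poly_P_nonzero_on_circle[OF assms(2)] by auto
    fix z assume z: "z \<in> {z. poly (P \<sigma>) z \<noteq> 0}"
    have "(f has_field_derivative deriv f z) (at z)"
      using assms(1) by (simp add: holomorphic_derivI)
    then have "((\<lambda>z. f z * poly (L v) z / poly (P \<sigma>) z) has_field_derivative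
        ((deriv f z * poly (L v) z + poly (pderiv (L v)) z * f z) * poly (P \<sigma>) z
          - f z * poly (L v) z * poly (pderiv (P \<sigma>)) z) / (poly (P \<sigma>) z * poly (P \<sigma>) z)) (at z)"
      using z by (intro DERIV_divide DERIV_mult poly_DERIV) auto
    also have "((deriv f z * poly (L v) z + poly (pderiv (L v)) z * f z) * poly (P \<sigma>) z
          - f z * poly (L v) z * poly (pderiv (P \<sigma>)) z) / (poly (P \<sigma>) z * poly (P \<sigma>) z) = ?D z - ?H z"
      using z by (intro quotient_rule_split) simp
    finally show "((\<lambda>z. f z * poly (L v) z / poly (P \<sigma>) z) has_field_derivative ?D z - ?H z)
                    (at z within {z. poly (P \<sigma>) z \<noteq> 0})"
      by (rule has_field_derivative_at_within)
  qed simp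
  then have "((\<lambda>z. ?D z - ?H z) has_contour_integral 0) ?C"
    by simp
  moreover have "(?H has_contour_integral contour_integral ?C ?H) ?C"
    using assms
    by (intro has_contour_integral_integral J_integrable holomorphic_on_imp_continuous_on
              holomorphic_intros holomorphic_deriv) auto
  ultimately have "((\<lambda>z. (?D z - ?H z) + ?H z) has_contour_integral 0 + contour_integral ?C ?H) ?C"
    by (rule has_contour_integral_add)
  then show ?thesis
    by (simp add: J_def contour_integral_unique)
qed

lemma has_complex_derivative_trace:
  assumes f: "f holomorphic_on UNIV" and \<sigma>: "norm \<sigma> < M"
  shows "has_complex_derivative (\<lambda>\<sigma>. \<Sum>x\<in>#proots (P \<sigma>). f x)
           (\<lambda>v. J M (\<lambda>z. - deriv f z * poly (L v) z) 1 \<sigma>) \<sigma>"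
proof -
  let ?R = "real k * M + 1"
  let ?C = "circlepath 0 ?R"
  let ?\<Phi> = "\<lambda>(\<sigma> :: complex ^ 'n) z. f z * poly (pderiv (P \<sigma>)) z / poly (P \<sigma>) z"
  let ?D = "\<lambda>(\<sigma> :: complex ^ 'n) z v. f z * poly (pderiv (P \<sigma>)) z * (- poly (L v) z / poly (P \<sigma>) z ^ 2)
                       + f z * poly (pderiv (L v)) z / poly (P \<sigma>) z"
  have cont_f: "continuous_on A f" for A
    using f by (rule holomorphic_on_imp_continuous_on[OF holomorphic_on_subset]) auto
  have "has_complex_derivative (\<lambda>\<sigma>. contour_integral ?C (?\<Phi> \<sigma>)) (\<lambda>v. contour_integral ?C (\<lambda>z. ?D \<sigma> z v)) \<sigma>"
  proof (rule has_complex_derivative_circle_integral)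
    show "convex (ball 0 M :: (complex ^ 'n) set)" "open (ball 0 M :: (complex ^ 'n) set)"
         "\<sigma> \<in> ball 0 M"
      using \<sigma> by auto
    fix \<sigma> :: "complex ^ 'n" assume "\<sigma> \<in> ball 0 M"
    then have nz: "poly (P \<sigma>) z \<noteq> 0" if "z \<in> sphere 0 \<bar>?R\<bar>" for z
      using that poly_P_nonzero_on_circle[of \<sigma> M z] by simp
    then show "continuous_on (sphere 0 \<bar>?R\<bar>) (?\<Phi> \<sigma>)"
      by (intro continuous_intros cont_f) auto
    fix z :: complex assume "z \<in> sphere 0 \<bar>?R\<bar>"
    have "has_complex_derivative (\<lambda>\<sigma>. f z * poly (pderiv (P \<sigma>)) z) (\<lambda>v. f z * poly (pderiv (L v)) z) \<sigma>"
      by (rule has_complex_derivative_compose[OF has_complex_derivative_poly_pderiv_P])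
         (auto intro!: derivative_eq_intros)
    moreover have "has_complex_derivative (\<lambda>\<sigma>. 1 / poly (P \<sigma>) z ^ 1)
        (\<lambda>v. - of_nat 1 * 1 / poly (P \<sigma>) z ^ Suc 1 * poly (L v) z) \<sigma>"
      by (intro has_complex_derivative_compose[OF has_complex_derivative_poly_P]
                has_field_derivative_const_over_power nz) fact
    ultimately have "has_complex_derivative (\<lambda>\<sigma>. f z * poly (pderiv (P \<sigma>)) z * (1 / poly (P \<sigma>) z ^ 1))
       (\<lambda>v. f z * poly (pderiv (P \<sigma>)) z * (- of_nat 1 * 1 / poly (P \<sigma>) z ^ Suc 1 * poly (L v) z)
            + f z * poly (pderiv (L v)) z * (1 / poly (P \<sigma>) z ^ 1)) \<sigma>"
      by (rule has_complex_derivative_mult)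
    then show "has_complex_derivative (\<lambda>\<sigma>. ?\<Phi> \<sigma> z) (?D \<sigma> z) \<sigma>"
      by (simp add: power2_eq_square)
  next
    fix v
    show "continuous_on (ball 0 M \<times> sphere 0 \<bar>?R\<bar>) (\<lambda>(\<sigma>, z). ?D \<sigma> z v)"
      unfolding case_prod_beta using poly_P_nonzero_on_circle[of _ M]
      by (intro continuous_intros continuous_on_poly_P continuous_on_compose2[OF cont_f[of UNIV]]) auto
  qed
  moreover have "((\<lambda>w. w / (2 * pi * \<i>)) has_field_derivative 1 / (2 * pi * \<i>)) (at w)" for w
    by (auto intro!: derivative_eq_intros)
  ultimately have "has_complex_derivative (\<lambda>\<sigma>. contour_integral ?C (?\<Phi> \<sigma>) / (2 * pi * \<i>))
      (\<lambda>v. 1 / (2 * pi * \<i>) * contour_integral ?C (\<lambda>z. ?D \<sigma> z v)) \<sigma>"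
    by (rule has_complex_derivative_compose)
  then have "has_complex_derivative (\<lambda>\<sigma>. contour_integral ?C (?\<Phi> \<sigma>) / (2 * pi * \<i>))
      (\<lambda>v. J M (\<lambda>z. - deriv f z * poly (L v) z) 1 \<sigma>) \<sigma>"
    by (simp only: circle_integral_by_parts[OF f \<sigma>, symmetric]) simp
  then show ?thesis
    by (rule has_complex_derivative_transform[of _ _ _ "ball 0 M"])
       (use \<sigma> in \<open>simp_all add: trace_eq_circle_integral[OF f, where M = M]\<close>)
qed

lemma J_poly_0:
  assumes "norm \<sigma> < M" "degree q + 2 \<le> k"
  shows "J M (poly q) 1 \<sigma> = 0"
proof -
  have "contour_integral (circlepath 0 (real k * M + 1)) (\<lambda>z. poly q z / poly (P \<sigma>) z) = 0"
    by (rule circle_integral_poly_fraction_0)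
       (use assms(2) radius_pos[OF assms(1)] roots_inside_circle[OF assms(1)] in simp_all)
  then show ?thesis
    by (simp add: J_def)
qed

section \<open>Trace functions with a given derivative\<close>

text \<open>
  With \<open>g = z^(k-h) g\<^sub>1 + q\<close> and \<open>f\<close> a primitive of \<open>- (-1)^h g\<^sub>1\<close>, the derivative of the trace of \<open>f\<close> is the
  integral of \<open>(g - q) / P\<^sub>\<sigma>\<close>, and \<open>q\<close> contributes nothing because \<open>deg q \<le> k - h - 1 \<le> k - 2\<close> or \<open>q = 0\<close>.
\<close>

lemma ex_trace_antiderivative:
  assumes "g holomorphic_on UNIV" "h \<in> {1..k}"
  shows "\<exists>F. trace_function k \<iota> F \<and> (\<forall>M \<sigma>. norm \<sigma> < M \<longrightarrow> pdiff \<iota> h F \<sigma> = J M g 1 \<sigma>)"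
proof -
  obtain g1 q where g1: "g1 holomorphic_on UNIV" and q: "q = 0 \<or> degree q < k - h"
    and g: "\<And>z. g z = z ^ (k - h) * g1 z + poly q z"
    using entire_division_with_remainder[OF assms(1)] by blast
  obtain f where f': "\<And>z. (f has_field_derivative - ((-1) ^ h * g1 z)) (at z)"
  proof -
    have "(\<lambda>z. - ((-1) ^ h * g1 z)) holomorphic_on UNIV"
      by (intro holomorphic_intros g1)
    then show ?thesis
      using holomorphic_convex_primitive'[of UNIV] that by auto
  qed
  then have f: "f holomorphic_on UNIV"
    by (auto simp: holomorphic_on_def field_differentiable_def)
  have deriv_f: "deriv f z = - ((-1) ^ h * g1 z)" for z
    using f' by (rule DERIV_imp_deriv)
  define F where "F = (\<lambda>\<sigma>. \<Sum>x\<in>#proots (P \<sigma>). f x)"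
  have F': "has_complex_derivative F (\<lambda>v. J M (\<lambda>z. - deriv f z * poly (L v) z) 1 \<sigma>) \<sigma>"
    if "norm \<sigma> < M" for \<sigma> M
    unfolding F_def by (rule has_complex_derivative_trace[OF f that])
  have "entire F"
    unfolding entire_iff using F'[OF less_add_one] by blast
  then have "trace_function k \<iota> F"
    unfolding trace_function_def F_def using f by blast
  moreover have "pdiff \<iota> h F \<sigma> = J M g 1 \<sigma>" if \<sigma>: "norm \<sigma> < M" for \<sigma> M
  proof -
    have cont: "continuous_on UNIV (\<lambda>z. z ^ (k - h) * g1 z)" "continuous_on UNIV (poly q)"
      using holomorphic_on_imp_continuous_on[OF g1] by (auto intro!: continuous_intros)
    have "pdiff \<iota> h F \<sigma> = J M (\<lambda>z. - deriv f z * poly (L (axis (\<iota> h) 1)) z) 1 \<sigma>"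
      by (rule pdiff_eq_derivative_axis[OF F'[OF \<sigma>]])
    also have "(\<lambda>z. - deriv f z * poly (L (axis (\<iota> h) 1)) z) = (\<lambda>z. z ^ (k - h) * g1 z)"
      by (simp add: fun_eq_iff deriv_f L_axis[OF assms(2)] poly_monom mult.commute)
    also have "J M \<dots> 1 \<sigma> = J M (\<lambda>z. z ^ (k - h) * g1 z) 1 \<sigma> + J M (poly q) 1 \<sigma>"
    proof (cases "q = 0")
      case False
      then have "degree q + 2 \<le> k"
        using q assms(2) by auto
      then show ?thesis
        by (simp add: J_poly_0[OF \<sigma>] del: One_nat_def)
    qed (simp add: J_def)
    also have "\<dots> = J M (\<lambda>z. z ^ (k - h) * g1 z + poly q z) 1 \<sigma>"
      by (rule J_add[OF \<sigma> cont, symmetric])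
    also have "(\<lambda>z. z ^ (k - h) * g1 z + poly q z) = g"
      by (simp add: g fun_eq_iff)
    finally show ?thesis .
  qed
  ultimately show ?thesis
    by blast
qed

end

theorem theorem5p2p3:
  fixes k :: nat and \<iota> :: "nat \<Rightarrow> 'n::finite" and G :: "complex ^ 'n \<Rightarrow> complex"
  assumes "k \<ge> 1"
    and "bij_betw \<iota> {1..k} (UNIV :: 'n set)"
    and "entire G"
    and "trace_form k \<iota> G"
  shows "(\<forall>p q. p \<in> {1..k} \<and> q \<in> {1..k} \<and> p + 1 \<in> {1..k} \<and> q - 1 \<in> {1..k} \<longrightarrow>
            (\<forall>\<sigma>. pdiff \<iota> p (pdiff \<iota> q G) \<sigma> - pdiff \<iota> (p + 1) (pdiff \<iota> (q - 1) G) \<sigma> = 0))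
       \<and> (\<forall>m\<in>{2..k}. \<forall>\<sigma>. T_op k \<iota> m G \<sigma> + pdiff \<iota> m G \<sigma> = 0)
       \<and> (\<forall>h\<in>{1..k}. \<exists>F. trace_function k \<iota> F \<and> (\<forall>\<sigma>. G \<sigma> = pdiff \<iota> h F \<sigma>))"
proof -
  interpret labelled_coordinates k \<iota>
    using assms(1,2) by unfold_locales
  obtain g where g: "g holomorphic_on UNIV"
    and G: "\<And>\<sigma>. discriminant (P \<sigma>) \<noteq> 0 \<Longrightarrow>
              G \<sigma> = (\<Sum>x\<in>#proots (P \<sigma>). g x / poly (pderiv (P \<sigma>)) x)"
    using assms(4) unfolding trace_form_def by blast
  have cont_g: "continuous_on UNIV g"
    using g by (rule holomorphic_on_imp_continuous_on)
  have G_eq: "G \<sigma> = J M g 1 \<sigma>" if "norm \<sigma> < M" for \<sigma> M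
    using trace_form_eq_J[OF assms(3) g G that] .
  have G1: "pdiff \<iota> q G \<sigma> = pdiff \<iota> q (J M g 1) \<sigma>" if "norm \<sigma> < M" for q \<sigma> M
    by (rule pdiff_cong[of "ball 0 M"]) (use that G_eq in auto)
  have G2: "pdiff \<iota> p (pdiff \<iota> q G) \<sigma> = pdiff \<iota> p (pdiff \<iota> q (J M g 1)) \<sigma>" if "norm \<sigma> < M" for p q \<sigma> M
    by (rule pdiff_cong[of "ball 0 M"]) (use that G1 in auto)
  show ?thesis
  proof (intro conjI allI impI ballI)
    fix p q and \<sigma> :: "complex ^ 'n"
    assume pq: "p \<in> {1..k} \<and> q \<in> {1..k} \<and> p + 1 \<in> {1..k} \<and> q - 1 \<in> {1..k}"
    have \<sigma>: "norm \<sigma> < norm \<sigma> + 1"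
      by simp
    have "k - p + (k - q) = k - (p + 1) + (k - (q - 1))" "p + q = p + 1 + (q - 1)"
      using pq by auto
    then show "pdiff \<iota> p (pdiff \<iota> q G) \<sigma> - pdiff \<iota> (p + 1) (pdiff \<iota> (q - 1) G) \<sigma> = 0"
      using pq by (simp only: G2[OF \<sigma>] J_second_derivative[OF \<sigma> cont_g]) simp
  next
    fix m and \<sigma> :: "complex ^ 'n"
    assume "m \<in> {2..k}"
    moreover have \<sigma>: "norm \<sigma> < norm \<sigma> + 1"
      by simp
    ultimately show "T_op k \<iota> m G \<sigma> + pdiff \<iota> m G \<sigma> = 0"
      using J_T_op[OF \<sigma> cont_g] by (simp only: T_op_def G1[OF \<sigma>] G2[OF \<sigma>])
  next
    fix h assume "h \<in> {1..k}"
    then obtain F where F: "trace_function k \<iota> F"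
      and F': "\<And>M \<sigma>. norm \<sigma> < M \<Longrightarrow> pdiff \<iota> h F \<sigma> = J M g 1 \<sigma>"
      using ex_trace_antiderivative[OF g] by blast
    have "G \<sigma> = pdiff \<iota> h F \<sigma>" for \<sigma>
      using G_eq[OF less_add_one] F'[OF less_add_one] by (rule trans[OF _ sym])
    with F show "\<exists>F. trace_function k \<iota> F \<and> (\<forall>\<sigma>. G \<sigma> = pdiff \<iota> h F \<sigma>)"
      by blast
  qed
qed

end
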